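(* Suppose that (i) $a(W)$ is nonincreasing; (ii) $\psi(W)$ is nondecreasing and $\lim_{W\to\infty}\psi(W)=1$; (iii) $\psi(W)\ge\psi_2(W)$, where $$\psi_2(W)=\min\left(1,\ \frac{\alpha_{p,n}(\boldsymbol\delta_\phi)}{p\,a(W)}\right).$$ Then $\hat R^*(\psi;\boldsymbol\delta_\phi)=\frac{pS}{n}a(W)\psi(W)$ improves on $\hat R^*_0(\boldsymbol\delta_\phi)=\frac{pS}{n}a(W)$, as an estimator of $R^*(\boldsymbol\delta_\phi)$, under the loss $L(\hat R^*;R^*(\boldsymbol\delta_\phi))=(\hat R^*-R^*(\boldsymbol\delta_\phi))^2$. Especially, $\hat R^*(\psi_2;\boldsymbol\delta_\phi)$ improves on $\hat R^*_0(\boldsymbol\delta_\phi)$.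
   Context: Let $p\ge 3$, $n\ge1$, and let $\boldsymbol X\sim N_p(\boldsymbol\theta,\sigma^2 I_p)$ and $S\sim\sigma^2\chi^2_n$ be independent, with $\boldsymbol\theta\in\mathbb R^p$ and $\sigma^2>0$ both unknown. Put $W=\|\boldsymbol X\|^2/S$ and $\lambda=\|\boldsymbol\theta\|^2/\sigma^2$. Consider the shrinkage estimator $\boldsymbol\delta_\phi=\left(1-\frac{\phi(W)}{W}\right)\boldsymbol X$, where $\phi$ is a locally absolutely continuous real function with $\phi$ and $\phi'$ finite, such that $\boldsymbol\delta_\phi$ improves on $\boldsymbol X$ under squared error loss. Its mean squared error is $R(\boldsymbol\delta_\phi)=E\|\boldsymbol\delta_\phi-\boldsymbol\theta\|^2$; thus $R(\boldsymbol\delta_\phi)\le p\sigma^2$ for all $(\boldsymbol\theta,\sigma^2)$. Put $g(W)=W^{n/2}\int_W^\infty t^{-n/2}\,\frac{h(t)}{t}\,dt$ with $h(W)=(p-2)\frac{\phi(W)}{W}+2\phi'(W)$, and $a(W)=\frac np\left(g(W)-\frac{\phi^2(W)}{W}\right)$; it is understood that $a(W)>0$. The uniformly minimum variance unbiased estimator of $R(\boldsymbol\delta_\phi)$ is $\hat R_0(\boldsymbol\delta_\phi)=\frac{pS}{n}(1-a(W))$. The risk reduction is $R^*(\boldsymbol\delta_\phi)=p\sigma^2-R(\boldsymbol\delta_\phi)$, whose uniformly minimum variance unbiased estimator is $\hat R^*_0(\boldsymbol\delta_\phi)=\frac{pS}{n}a(W)$. The ratio $R^*(\boldsymbol\delta_\phi)/\sigma^2$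 depends on the parameters only through $\lambda$; it is assumed that it is maximized at $\lambda=0$, and $\alpha_{p,n}(\boldsymbol\delta_\phi)$ denotes its value at $\lambda=0$. An estimator improves on another under a given loss if its risk (expected loss) is less than or equal to that of the other for all $(\boldsymbol\theta,\sigma^2)$. *)

theory Defs
  imports "HOL-Probability.Probability"
begin

definition locally_abs_cont_on :: "real set \<Rightarrow> (real \<Rightarrow> real) \<Rightarrow> bool" where
  "locally_abs_cont_on A f \<longleftrightarrow>
     (\<forall>u v. {u..v} \<subseteq> A \<longrightarrow>
       (\<forall>\<epsilon>>0. \<exists>\<delta>>0. \<forall>D :: (real \<times> real) set.
          finite D \<longrightarrow>
          (\<forall>(x, y)\<in>D. u \<le> x \<and> x \<le> y \<and> y \<le> v) \<longrightarrow>
          disjoint_family_on (\<lambda>(x, y). {x<..<y}) D \<longrightarrow>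
          (\<Sum>(x, y)\<in>D. y - x) < \<delta> \<longrightarrow>
          (\<Sum>(x, y)\<in>D. \<bar>f y - f x\<bar>) < \<epsilon>))"

text \<open>The law \<open>N\<^sub>p(\<theta>, \<sigma>\<^sup>2 I)\<close>: independent coordinates with variance \<open>\<sigma>\<^sup>2\<close>
  (the parameter \<open>\<sigma>\<close> of \<^const>\<open>normal_density\<close> is the standard deviation).\<close>

definition normal_vec :: "real ^ 'p::finite \<Rightarrow> real \<Rightarrow> (real ^ 'p) measure" where
  "normal_vec \<theta> \<sigma> =
     distr (\<Pi>\<^sub>M i\<in>UNIV. density lborel (\<lambda>x. ennreal (normal_density (\<theta> $ i) \<sigma> x)))
       borel (\<lambda>z. \<chi> i. z i)"

definition chi_square_density :: "nat \<Rightarrow> real \<Rightarrow> real" where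
  "chi_square_density n x =
     (if x > 0 then x powr (real n / 2 - 1) * exp (- x / 2) / (2 powr (real n / 2) * Gamma (real n / 2))
      else 0)"

definition chi_square :: "nat \<Rightarrow> real measure" where
  "chi_square n = density lborel (\<lambda>x. ennreal (chi_square_density n x))"

text \<open>The joint law of the independent observations \<open>(X, S)\<close> under the parameter \<open>(\<theta>, \<sigma>\<^sup>2)\<close>.\<close>

definition model :: "nat \<Rightarrow> real ^ 'p::finite \<Rightarrow> real \<Rightarrow> ((real ^ 'p) \<times> real) measure" where
  "model n \<theta> \<sigma> = normal_vec \<theta> \<sigma> \<Otimes>\<^sub>M distr (chi_square n) borel (\<lambda>q. \<sigma>\<^sup>2 * q)"

text \<open>A loss takes the parameters \<open>\<theta>\<close>, \<open>\<sigma>\<close> and the value of the estimator. Risks are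
  extended nonnegative, so an estimator with infinite expected loss has risk \<open>\<infinity>\<close>.\<close>

definition risk :: "nat \<Rightarrow> (real ^ 'p::finite \<Rightarrow> real \<Rightarrow> 'd \<Rightarrow> real) \<Rightarrow> ((real ^ 'p) \<times> real \<Rightarrow> 'd)
    \<Rightarrow> real ^ 'p \<Rightarrow> real \<Rightarrow> ennreal" where
  "risk n L \<delta> \<theta> \<sigma> = (\<integral>\<^sup>+ z. ennreal (L \<theta> \<sigma> (\<delta> z)) \<partial>model n \<theta> \<sigma>)"

definition improves_on :: "nat \<Rightarrow> (real ^ 'p::finite \<Rightarrow> real \<Rightarrow> 'd \<Rightarrow> real)
    \<Rightarrow> ((real ^ 'p) \<times> real \<Rightarrow> 'd) \<Rightarrow> ((real ^ 'p) \<times> real \<Rightarrow> 'd) \<Rightarrow> bool" where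
  "improves_on n L \<delta> \<delta>' \<longleftrightarrow> (\<forall>\<theta> \<sigma>. \<sigma> > 0 \<longrightarrow> risk n L \<delta> \<theta> \<sigma> \<le> risk n L \<delta>' \<theta> \<sigma>)"

definition squared_error :: "real ^ 'p::finite \<Rightarrow> real \<Rightarrow> real ^ 'p \<Rightarrow> real" where
  "squared_error \<theta> \<sigma> d = (norm (d - \<theta>))\<^sup>2"

definition W_stat :: "(real ^ 'p::finite) \<times> real \<Rightarrow> real" where
  "W_stat = (\<lambda>(x, s). (norm x)\<^sup>2 / s)"

definition shrinkage :: "(real \<Rightarrow> real) \<Rightarrow> (real ^ 'p::finite) \<times> real \<Rightarrow> real ^ 'p" where
  "shrinkage \<phi> = (\<lambda>(x, s). (1 - \<phi> (W_stat (x, s)) / W_stat (x, s)) *\<^sub>R x)"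

text \<open>The real-valued mean squared error \<open>R(\<delta>\<^sub>\<phi>)\<close>. Note that \<^const>\<open>enn2real\<close> sends \<open>\<infinity>\<close> to \<open>0\<close>; the
  definition is used only for \<open>\<delta>\<^sub>\<phi>\<close> improving on \<open>X\<close>, whose risk is then at most \<open>p \<sigma>\<^sup>2\<close>.\<close>

definition MSE :: "nat \<Rightarrow> (real \<Rightarrow> real) \<Rightarrow> real ^ 'p::finite \<Rightarrow> real \<Rightarrow> real" where
  "MSE n \<phi> \<theta> \<sigma> = enn2real (risk n squared_error (shrinkage \<phi>) \<theta> \<sigma>)"

definition risk_reduction :: "nat \<Rightarrow> (real \<Rightarrow> real) \<Rightarrow> real ^ 'p::finite \<Rightarrow> real \<Rightarrow> real" where
  "risk_reduction n \<phi> \<theta> \<sigma> = real CARD('p) * \<sigma>\<^sup>2 - MSE n \<phi> \<theta> \<sigma>"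

text \<open>The value of \<open>R\<^sup>*/\<sigma>\<^sup>2\<close> at \<open>\<lambda> = 0\<close>, that is at \<open>\<theta> = 0\<close>; the choice \<open>\<sigma> = 1\<close> is immaterial by
  \<open>risk_reduction_at_zero\<close> below.\<close>

definition alpha :: "'p::finite itself \<Rightarrow> nat \<Rightarrow> (real \<Rightarrow> real) \<Rightarrow> real" where
  "alpha _ n \<phi> = risk_reduction n \<phi> (0 :: real ^ 'p) 1 / 1\<^sup>2"

definition h_fun :: "nat \<Rightarrow> (real \<Rightarrow> real) \<Rightarrow> real \<Rightarrow> real" where
  "h_fun p \<phi> w = (real p - 2) * (\<phi> w / w) + 2 * deriv \<phi> w"

text \<open>The integral is over \<^const>\<open>lebesgue\<close>, the completion of \<^const>\<open>lborel\<close>, because \<^term>\<open>deriv \<phi>\<close> is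
  arbitrary on the null set where \<open>\<phi>\<close> is not differentiable.\<close>

definition g_fun :: "nat \<Rightarrow> nat \<Rightarrow> (real \<Rightarrow> real) \<Rightarrow> real \<Rightarrow> real" where
  "g_fun p n \<phi> w =
     w powr (real n / 2) * (LINT t:{w<..}|lebesgue. t powr (- real n / 2) * (h_fun p \<phi> t / t))"

definition a_fun :: "nat \<Rightarrow> nat \<Rightarrow> (real \<Rightarrow> real) \<Rightarrow> real \<Rightarrow> real" where
  "a_fun p n \<phi> w = real n / real p * (g_fun p n \<phi> w - (\<phi> w)\<^sup>2 / w)"

definition reduction_est0 :: "nat \<Rightarrow> (real \<Rightarrow> real) \<Rightarrow> (real ^ 'p::finite) \<times> real \<Rightarrow> real" where
  "reduction_est0 n \<phi> =
     (\<lambda>(x, s). real CARD('p) * s / real n * a_fun CARD('p) n \<phi> (W_stat (x, s)))"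

definition reduction_est ::
    "nat \<Rightarrow> (real \<Rightarrow> real) \<Rightarrow> (real \<Rightarrow> real) \<Rightarrow> (real ^ 'p::finite) \<times> real \<Rightarrow> real" where
  "reduction_est n \<phi> \<psi> =
     (\<lambda>(x, s). real CARD('p) * s / real n * a_fun CARD('p) n \<phi> (W_stat (x, s)) * \<psi> (W_stat (x, s)))"

definition reduction_loss ::
    "nat \<Rightarrow> (real \<Rightarrow> real) \<Rightarrow> real ^ 'p::finite \<Rightarrow> real \<Rightarrow> real \<Rightarrow> real" where
  "reduction_loss n \<phi> \<theta> \<sigma> d = (d - risk_reduction n \<phi> \<theta> \<sigma>)\<^sup>2"

definition psi2 :: "'p::finite itself \<Rightarrow> nat \<Rightarrow> (real \<Rightarrow> real) \<Rightarrow> real \<Rightarrow> real" where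
  "psi2 T n \<phi> w = min 1 (alpha T n \<phi> / (real CARD('p) * a_fun CARD('p) n \<phi> w))"

lemma measurable_vec_lambda [measurable]:
  "(\<lambda>z. \<chi> i. z i) \<in> (\<Pi>\<^sub>M i\<in>(UNIV :: 'p::finite set). (borel :: real measure)) \<rightarrow>\<^sub>M borel"
proof (subst borel_measurable_euclidean_space, intro ballI)
  fix b :: "real ^ 'p" assume "b \<in> Basis"
  then obtain i where "b = axis i 1" by (auto simp: Basis_vec_def)
  thus "(\<lambda>z. (\<chi> i. z i) \<bullet> b) \<in> borel_measurable (\<Pi>\<^sub>M i\<in>UNIV. borel)"
    by (simp add: inner_axis)
qed

lemma prob_space_normal_vec:
  assumes "\<sigma> > 0"
  shows "prob_space (normal_vec (\<theta> :: real ^ 'p::finite) \<sigma>)"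
proof -
  have "prob_space (\<Pi>\<^sub>M i\<in>(UNIV :: 'p set). density lborel (\<lambda>x. ennreal (normal_density (\<theta> $ i) \<sigma> x)))"
    by (intro prob_space_PiM prob_space_normal_density assms)
  thus ?thesis
    unfolding normal_vec_def by (rule prob_space.prob_space_distr) measurable
qed

lemma measurable_chi_square_density [measurable]: "chi_square_density n \<in> borel_measurable borel"
  unfolding chi_square_density_def[abs_def] by measurable

lemma prob_space_chi_square:
  assumes "n \<ge> 1"
  shows "prob_space (chi_square n)"
proof
  define k where "k = real n / 2"
  have k: "k > 0" using assms by (simp add: k_def)
  have G: "Gamma k > 0" using k by (rule Gamma_real_pos)
  have "emeasure (chi_square n) (space (chi_square n)) =
      (\<integral>\<^sup>+ x. ennreal (chi_square_density n x) \<partial>lborel)"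
    by (simp add: chi_square_def emeasure_density)
  also have "\<dots> = (\<integral>\<^sup>+ t. ennreal 2 * ennreal (chi_square_density n (0 + 2 * t)) \<partial>lborel)"
    by (subst nn_integral_real_affine[where c = 2 and t = 0]) (auto simp: nn_integral_cmult)
  also have "\<dots> = (\<integral>\<^sup>+ t. ennreal (1 / Gamma k) * ennreal (indicator {0..} t * t powr (k - 1) / exp t) \<partial>lborel)"
  proof (rule nn_integral_cong_AE, use AE_lborel_singleton[of 0] in eventually_elim)
    case (elim t)
    show ?case
    proof (cases "t > 0")
      case True
      have "2 * chi_square_density n (2 * t) =
          2 * ((2 * t) powr (k - 1) * exp (- t) / (2 powr k * Gamma k))"
        using True by (simp add: chi_square_density_def k_def)
      also have "(2 * t) powr (k - 1) = 2 powr k / 2 * t powr (k - 1)"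
        using True by (simp add: powr_mult powr_diff)
      finally have "2 * chi_square_density n (2 * t) = 1 / Gamma k * (t powr (k - 1) / exp t)"
        by (simp add: exp_minus field_simps)
      hence *: "2 * chi_square_density n (0 + 2 * t) =
          1 / Gamma k * (indicator {0..} t * t powr (k - 1) / exp t)"
        using True by simp
      have "ennreal 2 * ennreal (chi_square_density n (0 + 2 * t)) =
          ennreal (2 * chi_square_density n (0 + 2 * t))"
        by (rule ennreal_mult'[symmetric]) simp
      also have "\<dots> = ennreal (1 / Gamma k) * ennreal (indicator {0..} t * t powr (k - 1) / exp t)"
        unfolding * using G by (intro ennreal_mult') simp
      finally show ?thesis .
    qed (use elim in \<open>auto simp: chi_square_density_def\<close>)
  qed
  also have "\<dots> = ennreal (1 / Gamma k) * ennreal (Gamma k)"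
    by (subst nn_integral_cmult) (auto simp: Gamma_conv_nn_integral_real[OF k])
  also have "\<dots> = 1"
    using G by (simp add: ennreal_mult'[symmetric])
  finally show "emeasure (chi_square n) (space (chi_square n)) = 1" .
qed

lemma sets_chi_square [simp, measurable_cong]: "sets (chi_square n) = sets borel"
  by (simp add: chi_square_def)

lemma sets_normal_vec [simp, measurable_cong]: "sets (normal_vec \<theta> \<sigma>) = sets borel"
  by (simp add: normal_vec_def)

lemma prob_space_model:
  assumes "\<sigma> > 0" "n \<ge> 1"
  shows "prob_space (model n (\<theta> :: real ^ 'p::finite) \<sigma>)"
  unfolding model_def
  by (intro prob_space_pair prob_space_normal_vec prob_space.prob_space_distr
        prob_space_chi_square assms) measurable

lemma normal_vec_scale:
  assumes "c > 0" "\<sigma> > 0"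
  shows "normal_vec (0 :: real ^ 'p::finite) (c * \<sigma>) = distr (normal_vec 0 \<sigma>) borel (\<lambda>x. c *\<^sub>R x)"
proof -
  let ?N = "\<lambda>\<sigma>. density lborel (\<lambda>x. ennreal (normal_density 0 \<sigma> x))"
  have N: "?N (c * \<sigma>) = distr (?N \<sigma>) (?N (c * \<sigma>)) ((*) c)"
  proof -
    interpret prob_space "?N \<sigma>" by (rule prob_space_normal_density) fact
    have "distributed (?N \<sigma>) lborel (\<lambda>x. x) (normal_density 0 \<sigma>)"
      by (auto simp: distributed_def distr_id2)
    from normal_density_affine[OF this, of c 0] assms
    have "distributed (?N \<sigma>) lborel (\<lambda>x. c * x) (normal_density 0 (c * \<sigma>))" by simp
    hence "distr (?N \<sigma>) lborel ((*) c) = ?N (c * \<sigma>)" by (simp add: distributed_def)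
    moreover have "distr (?N \<sigma>) lborel ((*) c) = distr (?N \<sigma>) (?N (c * \<sigma>)) ((*) c)"
      by (rule distr_cong) auto
    ultimately show ?thesis by simp
  qed
  let ?P = "\<lambda>\<sigma>. \<Pi>\<^sub>M i\<in>(UNIV :: 'p set). ?N \<sigma>"
  have "distr (?P \<sigma>) (?P (c * \<sigma>)) (compose UNIV ((*) c)) =
      (\<Pi>\<^sub>M i\<in>(UNIV :: 'p set). distr (?N \<sigma>) (?N (c * \<sigma>)) ((*) c))"
    using assms
    by (intro distr_PiM_finite_prob_space')
       (auto intro!: prob_space_normal_density)
  hence P: "?P (c * \<sigma>) = distr (?P \<sigma>) (?P (c * \<sigma>)) (compose UNIV ((*) c))"
    by (simp only: N[symmetric])
  have m: "compose (UNIV :: 'p set) ((*) c) \<in> ?P \<sigma> \<rightarrow>\<^sub>M ?P (c * \<sigma>)"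
    unfolding compose_def by measurable
  have v: "(\<lambda>z. \<chi> i. z i) \<in> ?P \<tau> \<rightarrow>\<^sub>M borel" for \<tau>
    by measurable
  have "normal_vec (0 :: real ^ 'p) (c * \<sigma>) =
      distr (distr (?P \<sigma>) (?P (c * \<sigma>)) (compose UNIV ((*) c))) borel (\<lambda>z. \<chi> i. z i)"
    unfolding normal_vec_def by (subst P[symmetric]) simp
  also have "\<dots> = distr (?P \<sigma>) borel ((\<lambda>z. \<chi> i. z i) \<circ> compose UNIV ((*) c))"
    by (rule distr_distr[OF v m])
  also have "(\<lambda>z. \<chi> i. z i) \<circ> compose UNIV ((*) c) =
      (\<lambda>x :: real ^ 'p. c *\<^sub>R x) \<circ> (\<lambda>z. \<chi> i. z i)"
    by (auto simp: fun_eq_iff vec_eq_iff compose_def)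
  also have "distr (?P \<sigma>) borel \<dots> = distr (normal_vec (0 :: real ^ 'p) \<sigma>) borel (\<lambda>x. c *\<^sub>R x)"
    unfolding normal_vec_def zero_index
    by (rule distr_distr[OF _ v, symmetric]) measurable
  finally show ?thesis .
qed

lemma model_scale:
  assumes "c > 0" "\<sigma> > 0" "n \<ge> 1"
  shows "model n (0 :: real ^ 'p::finite) (c * \<sigma>) =
    distr (model n 0 \<sigma>) (borel \<Otimes>\<^sub>M borel) (\<lambda>(x, s). (c *\<^sub>R x, c\<^sup>2 * s))"
proof -
  let ?C = "\<lambda>\<sigma>. distr (chi_square n) borel (\<lambda>q. \<sigma>\<^sup>2 * q)"
  have C: "?C (c * \<sigma>) = distr (?C \<sigma>) borel (\<lambda>s. c\<^sup>2 * s)"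
  proof -
    have "(\<lambda>s. c\<^sup>2 * s) \<circ> (\<lambda>q. \<sigma>\<^sup>2 * q) = (\<lambda>q. (c * \<sigma>)\<^sup>2 * q)"
      by (auto simp: fun_eq_iff power_mult_distrib)
    thus ?thesis by (subst distr_distr) simp_all
  qed
  have "prob_space (distr (?C \<sigma>) borel (\<lambda>s. c\<^sup>2 * s))"
    by (intro prob_space.prob_space_distr prob_space_chi_square assms) measurable
  hence "sigma_finite_measure (distr (?C \<sigma>) borel (\<lambda>s. c\<^sup>2 * s))"
    by (rule prob_space_imp_sigma_finite)
  thus ?thesis
    unfolding model_def C normal_vec_scale[OF assms(1,2)]
    by (intro pair_measure_distr) measurable
qed

text \<open>No measurability of \<open>f\<close> is required here, so that the next two results hold for every \<open>\<phi>\<close>.\<close>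

lemma nn_integral_distr_scale_le:
  assumes T: "T \<in> M \<rightarrow>\<^sub>M N" and c: "c > 0" and f: "\<And>x. f (T x) = ennreal c * f' x"
  shows "(\<integral>\<^sup>+ y. f y \<partial>distr M N T) \<le> ennreal c * (\<integral>\<^sup>+ x. f' x \<partial>M)"
  unfolding nn_integral_def[of "distr M N T"]
proof (rule SUP_least)
  fix g assume "g \<in> {g. simple_function (distr M N T) g \<and> g \<le> f}"
  hence g: "simple_function (distr M N T) g" and gf: "g \<le> f" by auto
  have [measurable]: "g \<in> borel_measurable N"
    using borel_measurable_simple_function[OF g] by simp
  note T [measurable]
  have cc: "ennreal c * (ennreal (1 / c) * x) = x" for x
    using c by (simp add: mult.assoc[symmetric] ennreal_mult'[symmetric])
  have "integral\<^sup>S (distr M N T) g = (\<integral>\<^sup>+ y. g y \<partial>distr M N T)"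
    by (rule nn_integral_eq_simple_integral[OF g, symmetric])
  also have "\<dots> = (\<integral>\<^sup>+ x. g (T x) \<partial>M)"
    by (rule nn_integral_distr) measurable
  also have "\<dots> = (\<integral>\<^sup>+ x. ennreal c * (ennreal (1 / c) * g (T x)) \<partial>M)"
    by (simp only: cc)
  also have "\<dots> = ennreal c * (\<integral>\<^sup>+ x. ennreal (1 / c) * g (T x) \<partial>M)"
    by (rule nn_integral_cmult) measurable
  also have "\<dots> \<le> ennreal c * (\<integral>\<^sup>+ x. f' x \<partial>M)"
  proof (intro mult_left_mono nn_integral_mono)
    fix x
    have "ennreal (1 / c) * g (T x) \<le> ennreal (1 / c) * f (T x)"
      using gf by (intro mult_left_mono) (auto simp: le_fun_def)
    also have "\<dots> = f' x"
      using cc[of "f' x"] by (simp add: f mult_ac)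
    finally show "ennreal (1 / c) * g (T x) \<le> f' x" .
  qed auto
  finally show "integral\<^sup>S (distr M N T) g \<le> ennreal c * (\<integral>\<^sup>+ x. f' x \<partial>M)" .
qed

lemma risk_shrinkage_scale_le:
  assumes "c > 0" "\<sigma> > 0" "n \<ge> 1"
  shows "risk n squared_error (shrinkage \<phi>) (0 :: real ^ 'p::finite) (c * \<sigma>) \<le>
    ennreal (c\<^sup>2) * risk n squared_error (shrinkage \<phi>) (0 :: real ^ 'p) \<sigma>"
  unfolding risk_def model_scale[OF assms]
proof (rule nn_integral_distr_scale_le)
  show "(\<lambda>(x, s). (c *\<^sub>R x, c\<^sup>2 * s)) \<in> model n (0 :: real ^ 'p) \<sigma> \<rightarrow>\<^sub>M borel \<Otimes>\<^sub>M borel"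
    unfolding model_def by measurable
  fix z :: "(real ^ 'p) \<times> real"
  obtain x s where z: "z = (x, s)" by (cases z)
  have "W_stat (c *\<^sub>R x, c\<^sup>2 * s) = W_stat (x, s)"
    using assms by (simp add: W_stat_def power_mult_distrib)
  thus "ennreal (squared_error 0 (c * \<sigma>) (shrinkage \<phi> (case z of (x, s) \<Rightarrow> (c *\<^sub>R x, c\<^sup>2 * s)))) =
      ennreal (c\<^sup>2) * ennreal (squared_error 0 \<sigma> (shrinkage \<phi> z))"
    by (simp add: z squared_error_def shrinkage_def power_mult_distrib mult_ac
        ennreal_mult'[symmetric])
qed (use assms in simp)

lemma risk_reduction_at_zero:
  assumes "\<sigma> > 0" "n \<ge> 1"
  shows "risk_reduction n \<phi> (0 :: real ^ 'p::finite) \<sigma> / \<sigma>\<^sup>2 = alpha TYPE('p) n \<phi>"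
proof -
  let ?r = "risk n squared_error (shrinkage \<phi>) (0 :: real ^ 'p)"
  have "ennreal (\<sigma>\<^sup>2) * ?r 1 \<le> ennreal (\<sigma>\<^sup>2) * (ennreal ((1 / \<sigma>)\<^sup>2) * ?r \<sigma>)"
    using risk_shrinkage_scale_le[of "1 / \<sigma>" \<sigma> n \<phi>, where 'p = 'p] assms
    by (intro mult_left_mono) auto
  also have "\<dots> = ?r \<sigma>"
    using assms by (simp add: mult.assoc[symmetric] ennreal_mult'[symmetric] power_divide)
  finally have "?r \<sigma> = ennreal (\<sigma>\<^sup>2) * ?r 1"
    using risk_shrinkage_scale_le[of \<sigma> 1 n \<phi>, where 'p = 'p] assms by (intro antisym) auto
  thus ?thesis
    using assms by (simp add: alpha_def risk_reduction_def MSE_def enn2real_mult field_simps)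
qed

end

theory Submission
  imports Defs
begin

text \<open>With \<open>k = p/n\<close>, the two losses differ by \<open>k S a (1 - \<psi>) (k S a (1 + \<psi>) - 2 R\<^sup>*)\<close>. Here
  \<open>R\<^sup>* \<le> \<alpha> \<sigma>\<^sup>2\<close>, and \<open>\<psi> \<ge> \<psi>\<^sub>2\<close> gives \<open>\<alpha> \<le> p a \<psi>\<close> wherever \<open>\<psi> < 1\<close>, so the difference is at least
  \<open>k\<^sup>2 S (S - n \<sigma>\<^sup>2) c\<close> with \<open>c = a\<^sup>2 (1 - \<psi>\<^sup>2)\<close>. For fixed \<open>X\<close>, \<open>W\<close> decreases in \<open>S\<close>, hence \<open>c\<close> is a
  nondecreasing function of \<open>S\<close> and may be replaced by its value at \<open>S = n \<sigma>\<^sup>2\<close>, where the factor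
  \<open>S - n \<sigma>\<^sup>2\<close> changes sign. Finally \<open>E (S (S - n \<sigma>\<^sup>2)) = 2 n \<sigma>\<^sup>4 \<ge> 0\<close>.\<close>

section \<open>Chi-square moments and a comparison of integrals\<close>

text \<open>The recursion Gamma(k + 1) = k Gamma(k) at k = n/2. A factor x raises the degrees of
  freedom by two, so the moments below reduce to total mass 1.\<close>

lemma chi_square_density_shift:
  assumes "n \<ge> 1"
  shows "x * chi_square_density n x = real n * chi_square_density (n + 2) x"
proof (cases "x > 0")
  case True
  define k where "k = real n / 2"
  have k: "k > 0" "real n = 2 * k" "real (n + 2) / 2 = k + 1"
    using assms by (simp_all add: k_def)
  have "Gamma (k + 1) = k * Gamma k"
    using k by (intro Gamma_plus1) (auto elim!: nonpos_Ints_cases)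
  hence "chi_square_density (n + 2) x =
      x powr k * exp (- x / 2) / (2 * 2 powr k * (k * Gamma k))"
    using True unfolding chi_square_density_def k(3) by (simp add: powr_add)
  also have "x powr k = x * x powr (k - 1)"
    using True by (simp add: powr_mult_base)
  finally have "real n * chi_square_density (n + 2) x =
      2 * k * (x * x powr (k - 1) * exp (- x / 2) / (2 * 2 powr k * (k * Gamma k)))"
    using k(2) by simp
  also have "\<dots> = x * (x powr (k - 1) * exp (- x / 2) / (2 powr k * Gamma k))"
    using k(1) by simp
  also have "\<dots> = x * chi_square_density n x"
    using True by (simp add: chi_square_density_def k_def)
  finally show ?thesis ..
qed (simp add: chi_square_density_def)

lemma chi_square_density_nonneg [simp]: "n \<ge> 1 \<Longrightarrow> chi_square_density n x \<ge> 0"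
  by (auto simp: chi_square_density_def intro!: divide_nonneg_nonneg mult_nonneg_nonneg
      less_imp_le[OF Gamma_real_pos])

lemma nn_integral_chi_square_shift:
  assumes "n \<ge> 1" and [measurable]: "g \<in> borel_measurable borel"
  shows "(\<integral>\<^sup>+ x. ennreal x * g x \<partial>chi_square n) = of_nat n * (\<integral>\<^sup>+ x. g x \<partial>chi_square (n + 2))"
proof -
  have "ennreal (chi_square_density n x) * (ennreal x * g x) =
      of_nat n * (ennreal (chi_square_density (n + 2) x) * g x)" for x
  proof -
    have "ennreal (chi_square_density n x) * ennreal x =
        of_nat n * ennreal (chi_square_density (n + 2) x)"
      using arg_cong[OF chi_square_density_shift[OF assms(1), of x], of ennreal] assms(1)
      by (simp add: ennreal_mult' ennreal_mult'' ennreal_of_nat_eq_real_of_nat mult.commute)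
    thus ?thesis by (simp only: mult.assoc[symmetric])
  qed
  thus ?thesis
    by (simp add: chi_square_def nn_integral_density nn_integral_cmult)
qed

lemma nn_integral_chi_square_1:
  assumes "n \<ge> 1"
  shows "(\<integral>\<^sup>+ x. ennreal x \<partial>chi_square n) = of_nat n"
proof -
  interpret prob_space "chi_square (n + 2)" by (rule prob_space_chi_square) simp
  show ?thesis
    using nn_integral_chi_square_shift[OF assms, of "\<lambda>_. 1"] emeasure_space_1 by simp
qed

lemma nn_integral_chi_square_2:
  assumes "n \<ge> 1"
  shows "(\<integral>\<^sup>+ x. ennreal x * ennreal x \<partial>chi_square n) = of_nat n * of_nat (n + 2)"
  using nn_integral_chi_square_shift[OF assms, of ennreal] nn_integral_chi_square_1[of "n + 2"]
  by simp

lemma AE_chi_square_pos: "AE x in chi_square n. x > 0"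
  unfolding chi_square_def by (subst AE_density) (auto simp: chi_square_density_def)

text \<open>A comparison of expectations in which \<open>f\<close> and \<open>g\<close> may have infinite expectation.\<close>

lemma nn_integral_chi_square_mono:
  assumes n: "n \<ge> 1" and K: "K \<ge> 0"
    and [measurable]: "f \<in> borel_measurable borel" "g \<in> borel_measurable borel"
    and le: "\<And>q. q > 0 \<Longrightarrow> 0 \<le> f q \<and> f q + K * (q * (q - real n)) \<le> g q"
  shows "(\<integral>\<^sup>+ q. ennreal (f q) \<partial>chi_square n) \<le> (\<integral>\<^sup>+ q. ennreal (g q) \<partial>chi_square n)"
proof -
  let ?M = "chi_square n"
  \<comment> \<open>This is the expectation of \<open>K * n * q\<close>. Putting it on both sides
    avoids subtraction in \<open>ennreal\<close>; being finite, it cancels at the end. What remains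
    is E q = n and E q^2 = n(n + 2) >= n^2.\<close>
  let ?c = "ennreal K * (of_nat n * of_nat n)"
  have "(\<integral>\<^sup>+ q. ennreal (f q) \<partial>?M) + ?c \<le>
      (\<integral>\<^sup>+ q. ennreal (f q) \<partial>?M) + ennreal K * (of_nat n * of_nat (n + 2))"
    by (intro add_left_mono mult_left_mono) auto
  also have "\<dots> = (\<integral>\<^sup>+ q. ennreal (f q) + ennreal K * (ennreal q * ennreal q) \<partial>?M)"
    by (subst nn_integral_add) (simp_all add: nn_integral_cmult nn_integral_chi_square_2[OF n])
  also have "\<dots> \<le> (\<integral>\<^sup>+ q. ennreal (g q) + ennreal K * (of_nat n * ennreal q) \<partial>?M)"
  proof (rule nn_integral_mono_AE, use AE_chi_square_pos[of n] in eventually_elim)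
    case (elim q)
    have "ennreal (f q) + ennreal K * (ennreal q * ennreal q) = ennreal (f q + K * (q * q))"
      using elim K le[of q] by (simp add: ennreal_mult'[symmetric] ennreal_plus[symmetric] del: ennreal_plus)
    also have "\<dots> \<le> ennreal (g q + K * (real n * q))"
      using le[of q] elim by (intro ennreal_leI) (simp add: algebra_simps)
    \<comment> \<open>\<open>g q\<close> may be negative when q < n; \<open>ennreal\<close> then
      sends it to 0, which only enlarges the right-hand side.\<close>
    also have "\<dots> \<le> ennreal (g q) + ennreal (K * (real n * q))"
      using K elim by (cases "g q \<ge> 0") (auto simp: ennreal_neg intro!: ennreal_leI)
    also have "ennreal (K * (real n * q)) = ennreal K * (of_nat n * ennreal q)"
      using elim K by (simp add: ennreal_mult ennreal_of_nat_eq_real_of_nat)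
    finally show ?case .
  qed
  also have "\<dots> = (\<integral>\<^sup>+ q. ennreal (g q) \<partial>?M) + ?c"
    by (subst nn_integral_add) (simp_all add: nn_integral_cmult nn_integral_chi_square_1[OF n])
  finally show ?thesis
    by (subst (asm) (1 2) add.commute, subst (asm) ennreal_add_left_cancel_le)
      (auto simp: ennreal_mult_eq_top_iff)
qed

section \<open>Normal marginals, the risk of X and the sign of \<alpha>\<close>

lemma distr_normal_vec_component:
  assumes "\<sigma> > 0"
  shows "distr (normal_vec (\<theta> :: real ^ 'p::finite) \<sigma>) borel (\<lambda>x. x $ i) =
    density lborel (\<lambda>x. ennreal (normal_density (\<theta> $ i) \<sigma> x))"
proof -
  let ?N = "\<lambda>i. density lborel (\<lambda>x. ennreal (normal_density (\<theta> $ i) \<sigma> x))"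
  have "distr (normal_vec \<theta> \<sigma>) borel (\<lambda>x. x $ i) = distr (PiM UNIV ?N) borel (\<lambda>z. z i)"
    unfolding normal_vec_def by (subst distr_distr) (auto simp: comp_def)
  also have "\<dots> = distr (PiM UNIV ?N) (?N i) (\<lambda>z. z i)"
    by (rule distr_cong) auto
  also have "\<dots> = ?N i"
    using assms by (intro distr_PiM_component prob_space_normal_density) auto
  finally show ?thesis .
qed

text \<open>One coordinate suffices, since its law has a density. This excludes W = 0, where nothing
  is assumed about a and \<psi>.\<close>

lemma AE_normal_vec_nonzero:
  assumes "\<sigma> > 0"
  shows "AE x in normal_vec (\<theta> :: real ^ 'p::finite) \<sigma>. x \<noteq> 0"
proof -
  obtain i :: 'p where True by simp
  have "AE y in density lborel (\<lambda>x. ennreal (normal_density (\<theta> $ i) \<sigma> x)). y \<noteq> 0"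
    by (subst AE_density) (use AE_lborel_singleton[of 0] in auto)
  hence "AE x in normal_vec \<theta> \<sigma>. x $ i \<noteq> 0"
    unfolding distr_normal_vec_component[OF assms, symmetric] by (subst (asm) AE_distr_iff) auto
  thus ?thesis by eventually_elim auto
qed

text \<open>The squared norm splits into coordinates, each contributing its variance. This is the
  bound on the risk of the shrinkage estimator behind \<open>alpha_nonneg\<close>.\<close>

lemma risk_fst:
  assumes "\<sigma> > 0" "n \<ge> 1"
  shows "risk n squared_error fst (\<theta> :: real ^ 'p::finite) \<sigma> = ennreal (real CARD('p) * \<sigma>\<^sup>2)"
proof -
  let ?N = "normal_vec \<theta> \<sigma>" and ?C = "distr (chi_square n) borel (\<lambda>q. \<sigma>\<^sup>2 * q)"
  interpret C: prob_space ?C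
    by (intro prob_space.prob_space_distr prob_space_chi_square assms) measurable
  have comp: "(\<integral>\<^sup>+ x. ennreal ((x $ i - \<theta> $ i)\<^sup>2) \<partial>?N) = ennreal (\<sigma>\<^sup>2)" for i
  proof -
    have "(\<integral>\<^sup>+ x. ennreal ((x $ i - \<theta> $ i)\<^sup>2) \<partial>?N) =
        (\<integral>\<^sup>+ y. ennreal ((y - \<theta> $ i)\<^sup>2) \<partial>distr ?N borel (\<lambda>x. x $ i))"
      by (subst nn_integral_distr) auto
    also have "\<dots> = (\<integral>\<^sup>+ y. ennreal (normal_density (\<theta> $ i) \<sigma> y * (y - \<theta> $ i) ^ (2 * 1)) \<partial>lborel)"
      unfolding distr_normal_vec_component[OF assms(1)]
      by (subst nn_integral_density) (auto simp: ennreal_mult)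
    also have "\<dots> = ennreal (fact (2 * 1) / ((2 / \<sigma>\<^sup>2) ^ 1 * fact 1))"
      using normal_moment_even[OF assms(1), of "\<theta> $ i" 1]
      by (subst nn_integral_eq_integral) (auto simp: has_bochner_integral_iff)
    finally show ?thesis by simp
  qed
  have "risk n squared_error fst \<theta> \<sigma> = (\<integral>\<^sup>+ x. (\<integral>\<^sup>+ s. ennreal ((norm (x - \<theta>))\<^sup>2) \<partial>?C) \<partial>?N)"
    unfolding risk_def model_def squared_error_def
    by (subst C.nn_integral_fst[symmetric]) auto
  also have "\<dots> = (\<integral>\<^sup>+ x. ennreal ((norm (x - \<theta>))\<^sup>2) \<partial>?N)"
    by (simp add: C.emeasure_space_1[simplified])
  also have "\<dots> = (\<integral>\<^sup>+ x. (\<Sum>i\<in>UNIV. ennreal ((x $ i - \<theta> $ i)\<^sup>2)) \<partial>?N)"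
    by (simp add: norm_vec_def L2_set_def sum_nonneg)
  also have "\<dots> = (\<Sum>i\<in>(UNIV :: 'p set). ennreal (\<sigma>\<^sup>2))"
    by (subst nn_integral_sum) (auto simp: comp)
  also have "\<dots> = ennreal (real CARD('p) * \<sigma>\<^sup>2)"
    by (subst sum_ennreal) auto
  finally show ?thesis .
qed

text \<open>The sign of \<alpha> makes \<open>psi2\<close> nonnegative and, with a nonincreasing,
  makes it nondecreasing.\<close>

lemma alpha_nonneg:
  assumes "improves_on n squared_error (shrinkage \<phi> :: (real ^ 'p::finite) \<times> real \<Rightarrow> real ^ 'p) fst"
    and "n \<ge> 1"
  shows "alpha TYPE('p) n \<phi> \<ge> 0"
proof -
  have "risk n squared_error (shrinkage \<phi>) (0 :: real ^ 'p) 1 \<le> ennreal (real CARD('p))"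
    using assms(1)[unfolded improves_on_def, rule_format, of 1 0]
      risk_fst[of 1 n "0 :: real ^ 'p"] assms(2) by simp
  hence "MSE n \<phi> (0 :: real ^ 'p) 1 \<le> real CARD('p)"
    unfolding MSE_def by (intro enn2real_leI) auto
  thus ?thesis by (simp add: alpha_def risk_reduction_def)
qed

section \<open>Measurability from monotonicity, and the pointwise loss bound\<close>

text \<open>The functions a and \<psi> get their measurability from monotonicity on the positive
  half-line; the extension by 0 makes it a statement on the whole line.\<close>

lemma borel_measurable_mono_on_pos:
  fixes f :: "real \<Rightarrow> real"
  assumes "mono_on {0<..} f"
  shows "(\<lambda>w. if w > 0 then f w else 0) \<in> borel_measurable borel"
  using borel_measurable_mono_on_fnc[OF assms] measurable_restrict_space_iff[of "{0<..}" borel 0 borel f]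
  by simp

text \<open>Here \<open>q = S/\<sigma>\<^sup>2\<close>, and \<open>a\<close>, \<open>P\<close> are the values of \<open>a\<close>, \<open>\<psi>\<close> at the observed \<open>W\<close>, while \<open>a'\<close>, \<open>P'\<close> are
  those at \<open>q = n\<close>.\<close>

lemma loss_difference_bound:
  fixes a :: real
  assumes pos: "a > 0" "a' > 0" "q > 0" "t > 0" "p > 0" "n > 0"
    and P: "0 \<le> P" "P \<le> 1" "0 \<le> P'" "P' \<le> 1"
    and up: "q \<ge> n \<Longrightarrow> a \<ge> a' \<and> P \<le> P'" and down: "q \<le> n \<Longrightarrow> a \<le> a' \<and> P' \<le> P"
    and R: "R \<le> \<alpha> * t" and \<alpha>: "P < 1 \<Longrightarrow> \<alpha> \<le> p * a * P"
  shows "(p * (t * q) / n * a * P - R)\<^sup>2 + (p * t / n)\<^sup>2 * (a'\<^sup>2 * (1 - P'\<^sup>2)) * (q * (q - n))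
    \<le> (p * (t * q) / n * a - R)\<^sup>2"
proof -
  define m where "m = p * t / n"
  have m: "m > 0" using pos by (simp add: m_def)
  have mono: "a'\<^sup>2 * (1 - P'\<^sup>2) * (q - n) \<le> a\<^sup>2 * (1 - P\<^sup>2) * (q - n)"
  proof (cases "q \<ge> n")
    case True
    have "a'\<^sup>2 * (1 - P'\<^sup>2) \<le> a\<^sup>2 * (1 - P\<^sup>2)"
      using up[OF True] pos P
      by (intro mult_mono diff_left_mono power_mono) (auto simp: power_le_one)
    thus ?thesis using True by (intro mult_right_mono) auto
  next
    case False
    have "a\<^sup>2 * (1 - P\<^sup>2) \<le> a'\<^sup>2 * (1 - P'\<^sup>2)"
      using down False pos P
      by (intro mult_mono diff_left_mono power_mono) (auto simp: power_le_one)
    thus ?thesis using False by (intro mult_right_mono_neg) auto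
  qed
  \<comment> \<open>The bound on \<alpha> is available only for P < 1; at P = 1 the factor 1 - P
    kills both sides.\<close>
  have R': "(1 - P) * R \<le> (1 - P) * (m * n * a * P)"
  proof (cases "P < 1")
    case True
    have "R \<le> \<alpha> * t" by (fact R)
    also have "\<dots> \<le> p * a * P * t"
      using \<alpha>[OF True] pos by (intro mult_right_mono) auto
    also have "\<dots> = m * n * a * P" using pos by (simp add: m_def)
    finally show ?thesis using P by (intro mult_left_mono) auto
  qed (use P in auto)
  have "m\<^sup>2 * (a'\<^sup>2 * (1 - P'\<^sup>2)) * (q * (q - n)) = m\<^sup>2 * q * (a'\<^sup>2 * (1 - P'\<^sup>2) * (q - n))"
    by (simp add: algebra_simps)
  also have "\<dots> \<le> m\<^sup>2 * q * (a\<^sup>2 * (1 - P\<^sup>2) * (q - n))"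
    using mono pos by (intro mult_left_mono) auto
  \<comment> \<open>Writing n(1 + P) = 2nP + n(1 - P) isolates the term 2nP that \<open>R'\<close>
    turns into R; the leftover square has a favourable sign and is dropped.\<close>
  also have "\<dots> = m\<^sup>2 * q * a\<^sup>2 * (1 - P) * (q * (1 + P) - 2 * n * P) - m\<^sup>2 * q * a\<^sup>2 * n * (1 - P)\<^sup>2"
    by (simp add: power2_eq_square algebra_simps)
  also have "\<dots> \<le> m\<^sup>2 * q * a\<^sup>2 * (1 - P) * (q * (1 + P) - 2 * n * P)"
    using pos by simp
  also have "\<dots> = (m * q * a)\<^sup>2 * (1 - P\<^sup>2) - 2 * (m * q * a) * ((1 - P) * (m * n * a * P))"
    by (simp add: power2_eq_square algebra_simps)
  also have "\<dots> \<le> (m * q * a)\<^sup>2 * (1 - P\<^sup>2) - 2 * (m * q * a) * ((1 - P) * R)"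
    using pos m by (intro diff_left_mono mult_left_mono[OF R']) auto
  also have "\<dots> = (m * q * a - R)\<^sup>2 - (m * q * a * P - R)\<^sup>2"
    by (simp add: power2_eq_square algebra_simps)
  finally show ?thesis by (simp add: m_def algebra_simps)
qed

section \<open>Integration over the model\<close>

text \<open>The hypothesis \<psi> \<le> 1 lets one statement serve both a \<psi> with limit 1 and
  \<open>psi2\<close>, which is capped at 1 by its definition.\<close>

lemma reduction_est_improves:
  assumes n: "n \<ge> 1"
    and imp: "improves_on n squared_error (shrinkage \<phi> :: (real ^ 'p::finite) \<times> real \<Rightarrow> real ^ 'p) fst"
    and a_pos: "\<forall>w>0. a_fun CARD('p) n \<phi> w > 0"
    and max_at_0: "\<forall>(\<theta> :: real ^ 'p) \<sigma>. \<sigma> > 0 \<longrightarrow> risk_reduction n \<phi> \<theta> \<sigma> / \<sigma>\<^sup>2 \<le> alpha TYPE('p) n \<phi>"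
    and a_mono: "antimono_on {0<..} (a_fun CARD('p) n \<phi>)"
    and \<psi>_mono: "mono_on {0<..} \<psi>"
    and \<psi>_le_1: "\<And>w. w > 0 \<Longrightarrow> \<psi> w \<le> 1"
    and \<psi>_ge: "\<forall>w>0. \<psi> w \<ge> psi2 TYPE('p) n \<phi> w"
  shows "improves_on n (reduction_loss n \<phi>)
           (reduction_est n \<phi> \<psi> :: (real ^ 'p) \<times> real \<Rightarrow> real) (reduction_est0 n \<phi>)"
  unfolding improves_on_def
proof (intro allI impI)
  fix \<theta> :: "real ^ 'p" and \<sigma> :: real
  assume \<sigma>: "\<sigma> > 0"
  let ?a = "a_fun CARD('p) n \<phi>" and ?\<alpha> = "alpha TYPE('p) n \<phi>" and ?p = "real CARD('p)"
  let ?N = "normal_vec \<theta> \<sigma>" and ?C = "distr (chi_square n) borel (\<lambda>q. \<sigma>\<^sup>2 * q)"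
  define R where "R = risk_reduction n \<phi> \<theta> \<sigma>"
  define A where "A = (\<lambda>w. if w > 0 then ?a w else 0)"
  define \<Psi> where "\<Psi> = (\<lambda>w. if w > 0 then \<psi> w else 0)"
  have n0: "real n > 0" using n by simp
  have R: "R \<le> ?\<alpha> * \<sigma>\<^sup>2"
    using max_at_0 \<sigma> by (auto simp: R_def divide_le_eq)
  have \<alpha>: "?\<alpha> \<ge> 0" using imp n by (rule alpha_nonneg)
  have \<psi>0: "\<psi> w \<ge> 0" if "w > 0" for w
  proof -
    have "psi2 TYPE('p) n \<phi> w \<ge> 0"
      using \<alpha> a_pos[rule_format, OF that] by (simp add: psi2_def)
    thus ?thesis using \<psi>_ge that by (meson order_trans)
  qed
  have "mono_on {0<..} (\<lambda>w. - ?a w)"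
    using a_mono by (auto simp: monotone_on_def)
  from borel_measurable_uminus[OF borel_measurable_mono_on_pos[OF this]]
  have [measurable]: "A \<in> borel_measurable borel"
    unfolding A_def by (simp add: if_distrib cong: if_cong)
  have [measurable]: "\<Psi> \<in> borel_measurable borel"
    unfolding \<Psi>_def by (rule borel_measurable_mono_on_pos[OF \<psi>_mono])
  \<comment> \<open>\<open>F\<close> and \<open>G\<close> are Borel versions of the two losses. They
    agree with the losses where X is nonzero and S > 0, hence almost everywhere, so Tonelli applies
    to them.\<close>
  define F where "F = (\<lambda>(x :: real ^ 'p) s. (?p * s / real n * A ((norm x)\<^sup>2 / s) * \<Psi> ((norm x)\<^sup>2 / s) - R)\<^sup>2)"
  define G where "G = (\<lambda>(x :: real ^ 'p) s. (?p * s / real n * A ((norm x)\<^sup>2 / s) - R)\<^sup>2)"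
  have mF [measurable]: "case_prod F \<in> borel_measurable (borel \<Otimes>\<^sub>M borel)"
    unfolding F_def by measurable
  have mG [measurable]: "case_prod G \<in> borel_measurable (borel \<Otimes>\<^sub>M borel)"
    unfolding G_def by measurable
  interpret C: prob_space ?C
    by (intro prob_space.prob_space_distr prob_space_chi_square n) measurable
  interpret N: prob_space ?N
    by (rule prob_space_normal_vec[OF \<sigma>])
  interpret pair_prob_space ?N ?C ..
  have s_pos: "AE s in ?C. s > 0"
    using AE_chi_square_pos[of n] \<sigma> by (subst AE_distr_iff) auto
  have "AE x in ?N. AE s in ?C. fst (x, s) \<noteq> 0 \<and> snd (x, s) > 0"
    using AE_normal_vec_nonzero[OF \<sigma>, of \<theta>]
  proof eventually_elim
    case (elim x)
    from s_pos show ?case by eventually_elim (use elim in auto)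
  qed
  moreover have "{z \<in> space (?N \<Otimes>\<^sub>M ?C). fst z \<noteq> 0 \<and> snd z > 0} \<in> sets (?N \<Otimes>\<^sub>M ?C)"
    by measurable
  ultimately have AE: "AE z in model n \<theta> \<sigma>. fst z \<noteq> 0 \<and> snd z > 0"
    unfolding model_def by (intro AE_pair_measure)
  have "risk n (reduction_loss n \<phi>) (reduction_est n \<phi> \<psi>) \<theta> \<sigma> =
      (\<integral>\<^sup>+ z. ennreal (case_prod F z) \<partial>model n \<theta> \<sigma>)"
    unfolding risk_def
    by (rule nn_integral_cong_AE, use AE in eventually_elim)
      (auto simp: reduction_loss_def reduction_est_def F_def A_def \<Psi>_def R_def W_stat_def)
  also have "\<dots> = (\<integral>\<^sup>+ x. (\<integral>\<^sup>+ q. ennreal (F x (\<sigma>\<^sup>2 * q)) \<partial>chi_square n) \<partial>?N)"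
    unfolding model_def
    by (subst C.nn_integral_fst[symmetric], measurable) (simp add: nn_integral_distr)
  also have "\<dots> \<le> (\<integral>\<^sup>+ x. (\<integral>\<^sup>+ q. ennreal (G x (\<sigma>\<^sup>2 * q)) \<partial>chi_square n) \<partial>?N)"
  proof (rule nn_integral_mono_AE, use AE_normal_vec_nonzero[OF \<sigma>, of \<theta>] in eventually_elim)
    case (elim x)
    \<comment> \<open>For fixed x this is W as a function of q = S/\<sigma>^2, and it is decreasing;
      so a is nondecreasing and \<psi> nonincreasing in q.\<close>
    define w where "w = (\<lambda>q. (norm x)\<^sup>2 / (\<sigma>\<^sup>2 * q))"
    have w: "w q > 0" if "q > 0" for q using that elim \<sigma> by (simp add: w_def)
    have w_anti: "w q' \<le> w q" if "0 < q" "q \<le> q'" for q q'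
      using that \<sigma> by (auto simp: w_def intro!: divide_left_mono mult_left_mono)
    have a_w: "?a (w q) \<le> ?a (w q')" and \<psi>_w: "\<psi> (w q') \<le> \<psi> (w q)" if "0 < q" "q \<le> q'" for q q'
      using that w w_anti[OF that] a_mono \<psi>_mono by (auto simp: monotone_on_def)
    \<comment> \<open>a and \<psi> are frozen at q = n, the mean of q, so \<open>?K\<close> depends
      on x alone.\<close>
    let ?K = "(?p * \<sigma>\<^sup>2 / real n)\<^sup>2 * ((?a (w n))\<^sup>2 * (1 - (\<psi> (w n))\<^sup>2))"
    show ?case
    proof (rule nn_integral_chi_square_mono[OF n, where K = ?K])
      show "?K \<ge> 0"
        using \<psi>0[OF w[OF n0]] \<psi>_le_1[OF w[OF n0]] by (auto simp: power_le_one)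
    next
      fix q :: real assume q: "q > 0"
      have "F x (\<sigma>\<^sup>2 * q) + ?K * (q * (q - real n)) \<le> G x (\<sigma>\<^sup>2 * q)"
      proof -
        have "?\<alpha> \<le> ?p * ?a (w q) * \<psi> (w q)" if "\<psi> (w q) < 1"
        proof -
          \<comment> \<open>As \<psi> < 1 here, the minimum in \<open>psi2\<close> is not attained
            by 1 and must be the quotient.\<close>
          have "?\<alpha> / (?p * ?a (w q)) \<le> \<psi> (w q)"
            using \<psi>_ge w[OF q] that by (fastforce simp: psi2_def min_le_iff_disj)
          thus ?thesis using a_pos w[OF q] by (simp add: divide_le_eq mult_ac)
        qed
        from loss_difference_bound[OF _ _ q _ _ n0 _ _ _ _ _ _ R this]
        have "(?p * (\<sigma>\<^sup>2 * q) / n * ?a (w q) * \<psi> (w q) - R)\<^sup>2 + ?K * (q * (q - n))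
          \<le> (?p * (\<sigma>\<^sup>2 * q) / n * ?a (w q) - R)\<^sup>2"
          using a_pos w n0 q \<sigma> \<psi>0 \<psi>_le_1 a_w \<psi>_w by auto
        thus ?thesis using w[OF q] by (simp add: F_def G_def A_def \<Psi>_def w_def)
      qed
      thus "0 \<le> F x (\<sigma>\<^sup>2 * q) \<and> F x (\<sigma>\<^sup>2 * q) + ?K * (q * (q - real n)) \<le> G x (\<sigma>\<^sup>2 * q)"
        by (simp add: F_def)
    qed (simp_all add: F_def G_def)
  qed
  also have "\<dots> = (\<integral>\<^sup>+ z. ennreal (case_prod G z) \<partial>model n \<theta> \<sigma>)"
    unfolding model_def
    by (subst C.nn_integral_fst[symmetric], measurable) (simp add: nn_integral_distr)
  also have "\<dots> = risk n (reduction_loss n \<phi>) (reduction_est0 n \<phi>) \<theta> \<sigma>"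
    unfolding risk_def
    by (rule nn_integral_cong_AE, use AE in eventually_elim)
      (auto simp: reduction_loss_def reduction_est0_def G_def A_def R_def W_stat_def)
  finally show "risk n (reduction_loss n \<phi>) (reduction_est n \<phi> \<psi>) \<theta> \<sigma> \<le>
      risk n (reduction_loss n \<phi>) (reduction_est0 n \<phi>) \<theta> \<sigma>" .
qed

theorem theorem3:
  fixes n :: nat and \<phi> \<psi> :: "real \<Rightarrow> real"
  assumes p_ge_3: "CARD('p::finite) \<ge> 3"
    and n_ge_1: "n \<ge> 1"
    and \<phi>_lac: "locally_abs_cont_on {0<..} \<phi>"
    and \<phi>_diff: "AE w in lebesgue. w > 0 \<longrightarrow> \<phi> differentiable (at w)"
    and \<phi>_improves: "improves_on n squared_error (shrinkage \<phi> :: (real ^ 'p) \<times> real \<Rightarrow> real ^ 'p) fst"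
    and a_pos: "\<forall>w>0. a_fun CARD('p) n \<phi> w > 0"
    and max_at_0: "\<forall>(\<theta> :: real ^ 'p) \<sigma>. \<sigma> > 0 \<longrightarrow> risk_reduction n \<phi> \<theta> \<sigma> / \<sigma>\<^sup>2 \<le> alpha TYPE('p) n \<phi>"
    and a_mono: "antimono_on {0<..} (a_fun CARD('p) n \<phi>)"
    and \<psi>_mono: "mono_on {0<..} \<psi>"
    and \<psi>_lim: "(\<psi> \<longlongrightarrow> 1) at_top"
    and \<psi>_ge: "\<forall>w>0. \<psi> w \<ge> psi2 TYPE('p) n \<phi> w"
  shows "improves_on n (reduction_loss n \<phi>)
           (reduction_est n \<phi> \<psi> :: (real ^ 'p) \<times> real \<Rightarrow> real) (reduction_est0 n \<phi>)
       \<and> improves_on n (reduction_loss n \<phi>)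
           (reduction_est n \<phi> (psi2 TYPE('p) n \<phi>) :: (real ^ 'p) \<times> real \<Rightarrow> real) (reduction_est0 n \<phi>)"
proof (intro conjI reduction_est_improves[OF n_ge_1 \<phi>_improves a_pos max_at_0 a_mono])
  fix w :: real assume w: "w > 0"
  \<comment> \<open>A nondecreasing function stays below its limit at infinity.\<close>
  have "eventually (\<lambda>u. \<psi> w \<le> \<psi> u) at_top"
    using eventually_ge_at_top[of w]
  proof eventually_elim
    case (elim u)
    thus ?case using w \<psi>_mono by (auto simp: monotone_on_def)
  qed
  thus "\<psi> w \<le> 1"
    using \<psi>_lim by (intro tendsto_lowerbound) auto
next
  have \<alpha>: "alpha TYPE('p) n \<phi> \<ge> 0"
    using \<phi>_improves n_ge_1 by (rule alpha_nonneg)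
  show "mono_on {0<..} (psi2 TYPE('p) n \<phi>)"
  proof (rule mono_onI)
    fix u v :: real assume uv: "u \<in> {0<..}" "v \<in> {0<..}" "u \<le> v"
    have "a_fun CARD('p) n \<phi> v \<le> a_fun CARD('p) n \<phi> u"
      using a_mono uv by (auto simp: monotone_on_def)
    \<comment> \<open>The numerator \<alpha> is nonnegative and the positive denominator shrinks as
      w grows.\<close>
    thus "psi2 TYPE('p) n \<phi> u \<le> psi2 TYPE('p) n \<phi> v"
      unfolding psi2_def using uv a_pos \<alpha>
      by (intro min.mono order_refl divide_left_mono mult_left_mono mult_pos_pos) auto
  qed
qed (use \<psi>_mono \<psi>_ge in \<open>auto simp: psi2_def\<close>)

end
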